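(* Let $\mathbf V_{m}$ and $\mathbf Z_{m-1}$ ($m\ge1$) be generated by right-preconditioned rational Krylov applied to the linearization pencil $(\mathbf A,\mathbf B)$ (see context), and let $r_m$ be the dimension of the column space of $$[\,V_m^{[1]}\cdots V_m^{[d]}\ Z_{m-1}^{[1]}\cdots Z_{m-1}^{[d]}\,].$$ Let $\tilde d=\dim\bigl(\operatorname{span}\{v_1^{[1]},\dots,v_1^{[d]}\}\bigr)$. Then $$r_m\le\tilde d+c(m-1),$$ where $c=2$ in general, and $c=1$ if there exists $c_B\in\mathbb C^d$ such that $[B_1\ \cdots\ B_d]=c_B^{T}\otimes I_n$.
   Context: Linearization: $A_i,B_i\in\mathbb C^{n\times n}$ ($i=1,\dots,d$), $f(\mu)=[f_1(\mu)\cdots f_d(\mu)]^T\ne0$, $P(\mu)=\sum_{i=1}^d(A_i-\mu B_i)f_i(\mu)$, and $M,N\in\mathbb C^{(d-1)\times d}$ satisfy $(M-\mu N)f(\mu)=0$, $\operatorname{rank}(M-\mu N)=d-1$. The pencil is $$\mathbf A=\begin{bmatrix}A_1\ \cdots\ A_d\\ M\otimes I_n\end{bmatrix},\qquad \mathbf B=\begin{bmatrix}B_1\ \cdots\ B_d\\ N\otimes I_n\end{bmatrix}\in\mathbb C^{dn\times dn}.$$ Right-preconditioned rational Krylov with shifts $\sigma_1,\sigma_2,\dots$ (all $\mathbf A-\sigma_k\mathbf B$ invertible): start from a unit vector $\mathbf v_1\in\mathbb C^{dn}$; in step $k=1,2,\dots$ choose $t_k\in\mathbb C^k$, compute $\mathbf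 z_k=(\mathbf A-\sigma_k\mathbf B)^{-1}\mathbf V_kt_k$ with $\mathbf V_k=[\mathbf v_1\cdots\mathbf v_k]$, then $\mathbf x_k=\mathbf B\mathbf z_k$, and orthonormalize $\mathbf x_k$ against $\mathbf V_k$ to obtain $\mathbf v_{k+1}$ (no breakdown), i.e. $\mathbf x_k=\mathbf V_{k+1}h_k$ with $h_k\in\mathbb C^{k+1}$ having nonzero last entry and $\mathbf V_{k+1}$ having orthonormal columns. $\mathbf Z_k=[\mathbf z_1\cdots\mathbf z_k]$ ($\mathbf Z_0$ is empty). Blocks: any $\mathbf u\in\mathbb C^{dn}$ is split into consecutive blocks $u^{[1]},\dots,u^{[d]}\in\mathbb C^n$; likewise $\mathbf V_k$ is split into $V_k^{[i]}\in\mathbb C^{n\times k}$ and $\mathbf Z_k$ into $Z_k^{[i]}\in\mathbb C^{n\times k}$. *)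

theory Defs
  imports
    "Jordan_Normal_Form.DL_Rank"
    "Jordan_Normal_Form.Gauss_Jordan_Elimination"
    "Jordan_Normal_Form.Schur_Decomposition"
begin

text \<open>
  Families of matrices, vectors and blocks are numbered from 1, as in \<open>A\<^sub>1, \<dots>, A\<^sub>d\<close>; the
  entries of a single vector or matrix are numbered from 0, as in the matrix library.
\<close>

definition kronecker :: "complex mat \<Rightarrow> complex mat \<Rightarrow> complex mat" (infixl \<open>\<otimes>\<^sub>K\<close> 70) where
  "X \<otimes>\<^sub>K Y = mat (dim_row X * dim_row Y) (dim_col X * dim_col Y)
     (\<lambda>(r, c). X $$ (r div dim_row Y, c div dim_col Y) * Y $$ (r mod dim_row Y, c mod dim_col Y))"

text \<open>Horizontal concatenation of matrices with \<open>nr\<close> rows.\<close>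

definition hcat :: "nat \<Rightarrow> complex mat list \<Rightarrow> complex mat" where
  "hcat nr Xs = mat_of_cols nr (concat (map cols Xs))"

text \<open>The \<open>i\<close>-th block (\<open>1 \<le> i \<le> d\<close>) of \<open>n\<close> consecutive entries of a vector, respectively of
  \<open>n\<close> consecutive rows of a matrix.\<close>

definition vec_block :: "nat \<Rightarrow> nat \<Rightarrow> complex vec \<Rightarrow> complex vec" where
  "vec_block n i u = vec n (\<lambda>r. u $ ((i - 1) * n + r))"

definition mat_block :: "nat \<Rightarrow> nat \<Rightarrow> complex mat \<Rightarrow> complex mat" where
  "mat_block n i X = mat n (dim_col X) (\<lambda>(r, c). X $$ ((i - 1) * n + r, c))"

definition (in vec_space) span_dim :: "'a vec set \<Rightarrow> nat" where
  "span_dim S = vectorspace.dim class_ring (span_vs S)"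

text \<open>\<open>\<Omega>\<close> is the set on which \<open>f\<close> and \<open>P\<close> are considered, e.g. the whole plane, or the
  complement of the poles of \<open>f\<close>.\<close>

definition linearization_data ::
  "nat \<Rightarrow> nat \<Rightarrow> complex set \<Rightarrow> (nat \<Rightarrow> complex mat) \<Rightarrow> (nat \<Rightarrow> complex mat) \<Rightarrow>
   (complex \<Rightarrow> complex vec) \<Rightarrow> (complex \<Rightarrow> complex mat) \<Rightarrow> complex mat \<Rightarrow> complex mat \<Rightarrow> bool" where
  "linearization_data n d \<Omega> A B f P M N \<longleftrightarrow>
     1 \<le> n \<and> 1 \<le> d \<and>
     (\<forall>i\<in>{1..d}. A i \<in> carrier_mat n n \<and> B i \<in> carrier_mat n n) \<and>
     M \<in> carrier_mat (d - 1) d \<and> N \<in> carrier_mat (d - 1) d \<and>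
     (\<forall>\<mu>\<in>\<Omega>. f \<mu> \<in> carrier_vec d \<and> f \<mu> \<noteq> 0\<^sub>v d \<and>
        P \<mu> = finsum (module_mat TYPE(complex) n n)
                (\<lambda>i. (f \<mu> $ (i - 1)) \<cdot>\<^sub>m (A i - \<mu> \<cdot>\<^sub>m B i)) {1..d} \<and>
        (M - \<mu> \<cdot>\<^sub>m N) *\<^sub>v f \<mu> = 0\<^sub>v (d - 1) \<and>
        vec_space.rank (d - 1) (M - \<mu> \<cdot>\<^sub>m N) = d - 1)"

text \<open>The matrix with block row \<open>[C\<^sub>1 \<dots> C\<^sub>d]\<close> on top of \<open>L \<otimes> I\<^sub>n\<close>; it yields both members of
  the linearization pencil.\<close>

definition pencil_mat :: "nat \<Rightarrow> nat \<Rightarrow> (nat \<Rightarrow> complex mat) \<Rightarrow> complex mat \<Rightarrow> complex mat" where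
  "pencil_mat n d C L = hcat n (map C [1..<d+1]) @\<^sub>r (L \<otimes>\<^sub>K 1\<^sub>m n)"

text \<open>The matrix \<open>[w\<^sub>1 \<dots> w\<^sub>k]\<close> with \<open>nr\<close> rows.\<close>

definition basis_mat :: "nat \<Rightarrow> (nat \<Rightarrow> complex vec) \<Rightarrow> nat \<Rightarrow> complex mat" where
  "basis_mat nr w k = mat_of_cols nr (map w [1..<k+1])"

definition orthonormal_cols :: "complex mat \<Rightarrow> bool" where
  "orthonormal_cols X \<longleftrightarrow> mat_adjoint X * X = 1\<^sub>m (dim_col X)"

text \<open>Steps \<open>1, \<dots>, m - 1\<close> of right-preconditioned rational Krylov without breakdown for a pencil
  of \<open>K \<times> K\<close> matrices, producing \<open>v\<^sub>1, \<dots>, v\<^sub>m\<close> and \<open>z\<^sub>1, \<dots>, z\<^bsub>m-1\<^esub>\<close>. The values of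
  the sequences at other indices are irrelevant.\<close>

definition rational_krylov ::
  "nat \<Rightarrow> complex mat \<Rightarrow> complex mat \<Rightarrow> nat \<Rightarrow> (nat \<Rightarrow> complex) \<Rightarrow> (nat \<Rightarrow> complex vec) \<Rightarrow>
   (nat \<Rightarrow> complex vec) \<Rightarrow> (nat \<Rightarrow> complex vec) \<Rightarrow> (nat \<Rightarrow> complex vec) \<Rightarrow> (nat \<Rightarrow> complex vec) \<Rightarrow> bool"
  where
  "rational_krylov K AA BB m \<sigma> t v z x h \<longleftrightarrow>
     v 1 \<in> carrier_vec K \<and> v 1 \<bullet>c v 1 = 1 \<and>
     (\<forall>k\<in>{1..<m}.
        invertible_mat (AA - \<sigma> k \<cdot>\<^sub>m BB) \<and>
        t k \<in> carrier_vec k \<and>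
        z k = the (mat_inverse (AA - \<sigma> k \<cdot>\<^sub>m BB)) *\<^sub>v (basis_mat K v k *\<^sub>v t k) \<and>
        x k = BB *\<^sub>v z k \<and>
        v (k + 1) \<in> carrier_vec K \<and>
        orthonormal_cols (basis_mat K v (k + 1)) \<and>
        h k \<in> carrier_vec (k + 1) \<and> h k $ k \<noteq> 0 \<and>
        x k = basis_mat K v (k + 1) *\<^sub>v h k)"

end

theory Submission
  imports Defs
begin

text \<open>
  Write \<open>A\<close> and \<open>B\<close>, without index, for the two matrices of the pencil.
  Let \<open>W\<^sub>k\<close> be the span of the blocks of \<open>v\<^sub>1, \<dots>, v\<^sub>k\<close> and \<open>z\<^sub>1, \<dots>, z\<^bsub>k-1\<^esub>\<close>. Then
  \<open>W\<^sub>1\<close> has dimension \<open>d'\<close>, \<open>W\<^sub>m\<close> is the column space whose dimension is \<open>r\<close>, and the claim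
  is that passing from \<open>W\<^sub>k\<close> to \<open>W\<^bsub>k+1\<^esub>\<close> costs at most two dimensions, and at most one if
  \<open>[B\<^sub>1 \<dots> B\<^sub>d] = c\<^sub>B\<^sup>T \<otimes> I\<^sub>n\<close>.

  The first dimension pays for the blocks of \<open>z\<^sub>k\<close>. With \<open>G = M - \<sigma>\<^sub>k N\<close>, the lower block rows
  of \<open>(A - \<sigma>\<^sub>k B) z\<^sub>k = V\<^sub>k t\<^sub>k\<close> say that the \<open>d - 1\<close> combinations of the blocks of \<open>z\<^sub>k\<close> with
  coefficients from the rows of \<open>G\<close> are blocks of \<open>V\<^sub>k t\<^sub>k\<close>, hence lie in \<open>W\<^sub>k\<close>. The rows of \<open>G\<close>
  are linearly independent, since \<open>A - \<sigma>\<^sub>k B\<close> is invertible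
  (\<open>shifted_pencil_rows_independent\<close>). So \<open>G\<close> becomes an invertible \<open>d \<times> d\<close> matrix after adding a
  suitable unit row, and solving the enlarged system expresses every block of \<open>z\<^sub>k\<close> by elements
  of \<open>W\<^sub>k\<close> and one single block of \<open>z\<^sub>k\<close> (\<open>corank_one_solutions_in_span_of_one_unknown\<close>).

  The second dimension pays for the first block \<open>[B\<^sub>1 \<dots> B\<^sub>d] z\<^sub>k\<close> of \<open>x\<^sub>k = B z\<^sub>k\<close>. It is free
  if \<open>[B\<^sub>1 \<dots> B\<^sub>d] = c\<^sub>B\<^sup>T \<otimes> I\<^sub>n\<close>, for then that block is a combination of the blocks of \<open>z\<^sub>k\<close>, as
  all the other blocks of \<open>x\<^sub>k\<close> are in any case (\<open>pencil_image_blocks_in_span\<close>). Finally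
  \<open>v\<^bsub>k+1\<^esub>\<close> is a combination of \<open>x\<^sub>k\<close> and \<open>v\<^sub>1, \<dots>, v\<^sub>k\<close>, because the last entry of \<open>h\<^sub>k\<close> is nonzero.

  The bookkeeping is done with finite generating sets (\<open>krylov_blocks_in_small_span\<close>); dimensions
  enter only for \<open>v\<^sub>1\<close> at the beginning and for the rank at the end.
\<close>

section \<open>Linear combinations and dimension\<close>

lemma (in vec_space) linear_combination_in_span:
  fixes u :: "nat \<Rightarrow> 'a vec"
  assumes "T \<subseteq> carrier_vec n" and "\<And>j. j < k \<Longrightarrow> u j \<in> span T"
  shows "vec n (\<lambda>r. \<Sum>j<k. c j * u j $ r) \<in> span T"
  using assms(2)
proof (induction k)
  case 0
  have "vec n (\<lambda>r. \<Sum>j<0. c j * u j $ r) = 0\<^sub>v n" by auto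
  then show ?case using in_spanI[of "0\<^sub>v n" "\<lambda>_. 0" "{}" T] by (simp add: lincomb_def module_vec_simps)
next
  case (Suc k)
  have u: "u k \<in> carrier_vec n"
    using Suc.prems[of k] span_closed[of T "u k"] assms(1) by (simp add: module_vec_simps)
  have "vec n (\<lambda>r. \<Sum>j<Suc k. c j * u j $ r)
      = vec n (\<lambda>r. \<Sum>j<k. c j * u j $ r) + c k \<cdot>\<^sub>v u k"
    using u by (intro eq_vecI) auto
  moreover have "c k \<cdot>\<^sub>v u k \<in> span T"
    using smult_in_span[OF assms(1)] Suc.prems by simp
  ultimately show ?case
    using span_add1[of T "vec n (\<lambda>r. \<Sum>j<k. c j * u j $ r)" "c k \<cdot>\<^sub>v u k"] Suc assms(1)
    by (simp add: module_vec_simps)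
qed

text \<open>
  Converts a dimension into the cardinality of a generating set.
\<close>

lemma (in vec_space) spanning_subset_of_size_span_dim:
  assumes "S \<subseteq> carrier_vec n" and "finite S"
  obtains T where "T \<subseteq> S" and "card T = span_dim S" and "S \<subseteq> span T" and "lin_indpt T"
proof -
  obtain T where max: "maximal T (\<lambda>T. T \<subseteq> S \<and> lin_indpt T)"
    using maximal_exists[of "\<lambda>T. T \<subseteq> S \<and> lin_indpt T" "card S" "{}"]
    by (meson assms(2) card_mono empty_iff empty_subsetI finite_lin_indpt2 rev_finite_subset)
  then have T: "T \<subseteq> S" "lin_indpt T" by (auto simp: maximal_def)
  have "s \<in> span T" if "s \<in> S" for s
  proof (rule ccontr)
    assume s: "s \<notin> span T"
    have TV: "T \<subseteq> carrier_vec n" using T assms by auto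
    have sT: "s \<notin> T" using s in_own_span[of T] TV by (auto simp: module_vec_simps)
    have "lin_indpt (T \<union> {s})"
      using lin_dep_iff_in_span[of T s] T TV sT s that assms by (auto simp: module_vec_simps)
    then show False
      using max sT that T unfolding maximal_def by blast
  qed
  moreover have "card T = span_dim S"
    using dim_span[OF _ assms(2) max] assms(1) by (simp add: span_dim_def module_vec_simps)
  ultimately show thesis using that T by blast
qed

text \<open>
  The converse conversion: by the replacement theorem, a maximal independent set of columns has
  no more elements than any finite set that generates all the columns.
\<close>

lemma (in vec_space) rank_le_card_generators:
  assumes "X \<in> carrier_mat n k" and "T \<subseteq> carrier_vec n" and "finite T"
    and "set (cols X) \<subseteq> span T"
  shows "rank X \<le> card T"
proof -
  have c: "set (cols X) \<subseteq> carrier_vec n" using assms(1) cols_dim by blast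
  obtain U where U: "U \<subseteq> set (cols X)" "card U = span_dim (set (cols X))" "lin_indpt U"
    by (rule spanning_subset_of_size_span_dim[OF c List.finite_set])
  have "rank X = card U" using U by (simp add: rank_def span_dim_def)
  moreover have "card U \<le> card T"
  proof -
    have "finite U" using U(1) by (rule finite_subset) simp
    moreover have "U \<subseteq> span T" using U(1) assms(4) by blast
    ultimately obtain C :: "'a vec set" where "int (card C) \<le> int (card T) - int (card U)"
      using replacement[of U T] U(3) assms(2,3) unfolding module_vec_simps by blast
    then show ?thesis by linarith
  qed
  ultimately show ?thesis by simp
qed

text \<open>
  Modulo \<open>span T\<close> the vectors \<open>u j\<close> solve the homogeneous system \<open>G u = 0\<close>. Since the rows of
  \<open>G\<close> are independent, the scalar solutions form a line, spanned by some \<open>g\<close>; so modulo \<open>span T\<close>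
  each \<open>u j\<close> is \<open>g j\<close> times one common vector, and \<open>u p\<close> can serve as that vector for every \<open>p\<close>
  with \<open>g p \<noteq> 0\<close>. The proof avoids quotient spaces by placing the \<open>p\<close>-th unit row on top of \<open>G\<close>
  and inverting the resulting square matrix.
\<close>

lemma (in vec_space) corank_one_solutions_in_span_of_one_unknown:
  fixes G :: "'a mat" and u :: "nat \<Rightarrow> 'a vec"
  assumes G: "G \<in> carrier_mat k (Suc k)"
    and rows: "\<And>y. y \<in> carrier_vec k \<Longrightarrow> transpose_mat G *\<^sub>v y = 0\<^sub>v (Suc k) \<Longrightarrow> y = 0\<^sub>v k"
    and T: "T \<subseteq> carrier_vec n"
    and u: "\<And>j. j < Suc k \<Longrightarrow> u j \<in> carrier_vec n"
    and eqs: "\<And>i. i < k \<Longrightarrow> vec n (\<lambda>r. \<Sum>j<Suc k. G $$ (i, j) * u j $ r) \<in> span T"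
  obtains p where "p < Suc k" and "\<And>j. j < Suc k \<Longrightarrow> u j \<in> span (insert (u p) T)"
proof -
  let ?d = "Suc k"
  \<comment> \<open>\<open>E a\<close> is \<open>G\<close> with the additional top row \<open>a\<close>; the zero row produces the kernel vector \<open>g\<close>,
    the \<open>p\<close>-th unit row the invertible matrix \<open>H\<close>.\<close>
  define E where "E a = mat ?d ?d (\<lambda>(i, j). if i = 0 then a j else G $$ (i - 1, j))" for a :: "nat \<Rightarrow> 'a"
  have E: "E a \<in> carrier_mat ?d ?d" for a by (simp add: E_def)
  have Emult: "E a *\<^sub>v g = vec ?d (\<lambda>i. if i = 0 then \<Sum>j<?d. a j * g $ j
      else \<Sum>j<?d. G $$ (i - 1, j) * g $ j)" if "g \<in> carrier_vec ?d" for a g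
    using that by (intro eq_vecI) (auto simp: E_def scalar_prod_def lessThan_atLeast0)
  have Gt: "transpose_mat (E a) *\<^sub>v y = vec ?d (\<lambda>j. a j * y $ 0 + (\<Sum>i<k. G $$ (i, j) * y $ (Suc i)))"
    if "y \<in> carrier_vec ?d" for a y
    using that by (intro eq_vecI)
      (auto simp: E_def scalar_prod_def lessThan_atLeast0 sum.atLeast0_lessThan_Suc_shift
        simp del: sum.op_ivl_Suc)
  have "det (E (\<lambda>_. 0)) = 0"
  proof -
    have "transpose_mat (E (\<lambda>_. 0)) *\<^sub>v unit_vec ?d 0 = 0\<^sub>v ?d"
      by (intro eq_vecI) (auto simp: Gt)
    then have "det (transpose_mat (E (\<lambda>_. 0))) = 0"
      using E det_0_iff_vec_prod_zero_field[of "transpose_mat (E (\<lambda>_. 0))" ?d]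
      by (metis transpose_carrier_mat unit_vec_carrier unit_vec_nonzero zero_less_Suc)
    then show ?thesis using det_transpose[OF E] by simp
  qed
  then obtain g where g: "g \<in> carrier_vec ?d" "g \<noteq> 0\<^sub>v ?d" "E (\<lambda>_. 0) *\<^sub>v g = 0\<^sub>v ?d"
    using det_0_iff_vec_prod_zero_field[OF E] by blast
  have Gg: "(\<Sum>j<?d. G $$ (i, j) * g $ j) = 0" if "i < k" for i
    using arg_cong[OF g(3), of "\<lambda>w. w $ Suc i"] that by (simp add: Emult[OF g(1)])
  obtain p where p: "p < ?d" "g $ p \<noteq> 0"
    using g(1,2) by (metis eq_vecI carrier_vecD index_zero_vec)
  have pick: "(\<Sum>j<?d. (if j = p then 1 else 0) * a j) = a p" for a :: "nat \<Rightarrow> 'a"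
    using p by (simp add: if_distrib[of "\<lambda>a. a * _"] sum.delta cong: if_cong del: sum.lessThan_Suc)
  define H where "H = E (\<lambda>j. if j = p then 1 else 0)"
  have H: "H \<in> carrier_mat ?d ?d" by (simp add: H_def E)
  have "det H \<noteq> 0"
  proof
    assume "det H = 0"
    then have "det (transpose_mat H) = 0" using det_transpose[OF H] by simp
    then obtain y where y: "y \<in> carrier_vec ?d" "y \<noteq> 0\<^sub>v ?d" "transpose_mat H *\<^sub>v y = 0\<^sub>v ?d"
      using det_0_iff_vec_prod_zero_field[of "transpose_mat H" ?d] H by auto
    \<comment> \<open>A linear relation \<open>y\<close> between the rows of \<open>H\<close>, paired with \<open>g\<close>, leaves only
      \<open>y $ 0 * g $ p\<close>; so the unit row does not occur in it, and it is a relation between the rows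
      of \<open>G\<close>.\<close>
    have "y \<bullet> (H *\<^sub>v g) = 0"
      using transpose_vec_mult_scalar[OF H g(1) y(1)] y(3) g(1) by simp
    moreover have "H *\<^sub>v g = g $ p \<cdot>\<^sub>v unit_vec ?d 0"
    proof (intro eq_vecI)
      fix i assume "i < dim_vec (g $ p \<cdot>\<^sub>v unit_vec ?d 0)"
      then show "(H *\<^sub>v g) $ i = (g $ p \<cdot>\<^sub>v unit_vec ?d 0) $ i"
        using Gg[of "i - 1"] pick[of "\<lambda>j. g $ j"] unfolding H_def Emult[OF g(1)]
        by (cases i) (simp_all del: sum.lessThan_Suc)
    qed (use H in simp)
    ultimately have y0: "y $ 0 = 0" using y(1) p by simp
    have "transpose_mat G *\<^sub>v vec k (\<lambda>i. y $ Suc i) = 0\<^sub>v ?d"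
    proof (intro eq_vecI)
      fix j assume "j < dim_vec (0\<^sub>v ?d :: 'a vec)"
      then have j: "j < ?d" by simp
      have "(\<Sum>i<k. G $$ (i, j) * y $ (Suc i)) = 0"
        using arg_cong[OF y(3), of "\<lambda>w. w $ j"] j y0 by (simp add: H_def Gt[OF y(1)])
      then show "(transpose_mat G *\<^sub>v vec k (\<lambda>i. y $ Suc i)) $ j = 0\<^sub>v ?d $ j"
        using G j by (simp add: scalar_prod_def lessThan_atLeast0)
    qed (use G in auto)
    then have "vec k (\<lambda>i. y $ Suc i) = 0\<^sub>v k" by (intro rows) auto
    then have ys: "y $ Suc i = 0" if "i < k" for i
      using that by (metis index_vec index_zero_vec(1))
    have "y $ i = 0" if "i < ?d" for i
      using that y0 ys by (cases i) auto
    then have "y = 0\<^sub>v ?d" using y(1) by (intro eq_vecI) auto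
    then show False using y(2) by simp
  qed
  then obtain R where R: "R \<in> carrier_mat ?d ?d" "R * H = 1\<^sub>m ?d"
    using det_non_zero_imp_unit[OF H] unfolding Units_def ring_mat_def by auto
  let ?S = "span (insert (u p) T)"
  have S: "insert (u p) T \<subseteq> carrier_vec n" using T u p by auto
  \<comment> \<open>The vectors \<open>w i\<close> are the right-hand sides of the enlarged system \<open>H u = w\<close>, and
    \<open>u = R w\<close>.\<close>
  define w where "w i = vec n (\<lambda>r. \<Sum>j<?d. H $$ (i, j) * u j $ r)" for i
  have w: "w i \<in> ?S" if "i < ?d" for i
  proof (cases i)
    case 0
    have "w 0 = u p"
      using u[OF p(1)] pick[of "\<lambda>j. u j $ _"]
      by (intro eq_vecI) (simp_all add: w_def H_def E_def del: sum.lessThan_Suc)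
    then show ?thesis using 0 in_own_span[of "insert (u p) T"] S by (auto simp: module_vec_simps)
  next
    case (Suc i')
    have "w i = vec n (\<lambda>r. \<Sum>j<?d. G $$ (i', j) * u j $ r)"
      using that unfolding w_def by (intro eq_vecI) (simp_all add: Suc H_def E_def del: sum.lessThan_Suc)
    then show ?thesis
      using eqs[of i'] that Suc span_is_monotone[of T "insert (u p) T"] by auto
  qed
  have "u j \<in> ?S" if j: "j < ?d" for j
  proof -
    have "vec n (\<lambda>r. \<Sum>i<?d. R $$ (j, i) * w i $ r) = u j"
    proof (intro eq_vecI)
      fix r assume "r < dim_vec (u j)"
      then have r: "r < n" using u[OF j] by simp
      have "(\<Sum>i<?d. R $$ (j, i) * w i $ r) = (\<Sum>i<?d. \<Sum>l<?d. R $$ (j, i) * H $$ (i, l) * u l $ r)"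
        using r by (simp add: w_def sum_distrib_left mult.assoc del: sum.lessThan_Suc)
      also have "\<dots> = (\<Sum>l<?d. (\<Sum>i<?d. R $$ (j, i) * H $$ (i, l)) * u l $ r)"
        by (subst sum.swap) (simp add: sum_distrib_right del: sum.lessThan_Suc)
      also have "\<dots> = (\<Sum>l<?d. (R * H) $$ (j, l) * u l $ r)"
        using R(1) H j
        by (intro sum.cong refl) (auto simp: scalar_prod_def lessThan_atLeast0 simp del: sum.op_ivl_Suc)
      also have "\<dots> = u j $ r"
        using j by (simp add: R(2) if_distrib[of "\<lambda>a. a * _"] sum.delta cong: if_cong
          del: sum.lessThan_Suc)
      finally show "vec n (\<lambda>r. \<Sum>i<?d. R $$ (j, i) * w i $ r) $ r = u j $ r" using r by simp
    qed (use u[OF j] in auto)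
    then show ?thesis
      using linear_combination_in_span[OF S, of ?d w "\<lambda>i. R $$ (j, i)"] w by simp
  qed
  then show thesis using that p(1) by blast
qed


section \<open>Blocks of vectors\<close>

definition blocks :: "nat \<Rightarrow> nat \<Rightarrow> complex vec \<Rightarrow> complex vec set" where
  "blocks n d u = (\<lambda>i. vec_block n i u) ` {1..d}"

lemma vec_block_carrier [simp]: "vec_block n i u \<in> carrier_vec n"
  by (simp add: vec_block_def)

lemma dim_vec_block [simp]: "dim_vec (vec_block n i u) = n"
  by (simp add: vec_block_def)

lemma vec_block_index [simp]: "r < n \<Longrightarrow> vec_block n (Suc j) u $ r = u $ (j * n + r)"
  by (simp add: vec_block_def)

lemma blocks_subset_iff: "blocks n d u \<subseteq> S \<longleftrightarrow> (\<forall>j<d. vec_block n (Suc j) u \<in> S)"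
  unfolding blocks_def image_Suc_lessThan[symmetric] by auto

lemma block_index_less: "j < d \<Longrightarrow> r < n \<Longrightarrow> j * n + r < d * (n :: nat)"
  using mult_le_mono1[of "Suc j" d n] by simp

lemma vec_block_linear_combination:
  assumes "j < d" and "\<And>r. r < d * n \<Longrightarrow> w $ r = (\<Sum>l<k. c l * u l $ r)"
  shows "vec_block n (Suc j) w = vec n (\<lambda>r. \<Sum>l<k. c l * vec_block n (Suc j) (u l) $ r)"
  using assms by (intro eq_vecI) (auto simp: block_index_less vec_block_def)

lemma basis_mat_carrier: "basis_mat K w k \<in> carrier_mat K k"
  unfolding basis_mat_def by (metis mat_of_cols_carrier(1) length_map length_upt diff_add_inverse2)

lemma basis_mat_mult_vec_index:
  assumes "q < K" and "t \<in> carrier_vec k"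
  shows "(basis_mat K w k *\<^sub>v t) $ q = (\<Sum>l<k. t $ l * w (Suc l) $ q)"
  using assms
  by (auto simp: basis_mat_def mat_of_cols_def scalar_prod_def lessThan_atLeast0 mult.commute
      simp del: upt_Suc intro!: sum.cong)

lemma col_mat_block_basis_mat:
  assumes "j < d" and "l < k"
  shows "col (mat_block n (Suc j) (basis_mat (d * n) w k)) l = vec_block n (Suc j) (w (Suc l))"
  using assms
  by (intro eq_vecI) (auto simp: mat_block_def basis_mat_def mat_of_cols_def block_index_less simp del: upt_Suc)

text \<open>
  \<open>X \<otimes> I\<^sub>n\<close> forms linear combinations of whole blocks: the \<open>i\<close>-th block of the product has the
  \<open>i\<close>-th row of \<open>X\<close> as coefficients.
\<close>

lemma kronecker_identity_mult_vec_index: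
  assumes X: "X \<in> carrier_mat p d" and u: "u \<in> carrier_vec (d * n)" and i: "i < p" and r: "r < n"
  shows "((X \<otimes>\<^sub>K 1\<^sub>m n) *\<^sub>v u) $ (i * n + r) = (\<Sum>j<d. X $$ (i, j) * u $ (j * n + r))"
proof -
  have ir: "i * n + r < p * n" by (rule block_index_less[OF i r])
  have row: "(X \<otimes>\<^sub>K 1\<^sub>m n) $$ (i * n + r, q) = X $$ (i, q div n) * (if q mod n = r then 1 else 0)"
    if "q < d * n" for q
    using X ir that r by (auto simp: kronecker_def)
  have "((X \<otimes>\<^sub>K 1\<^sub>m n) *\<^sub>v u) $ (i * n + r)
      = (\<Sum>q<d * n. X $$ (i, q div n) * (if q mod n = r then 1 else 0) * u $ q)"
    using X u ir
    by (auto simp: scalar_prod_def lessThan_atLeast0 row[symmetric] kronecker_def intro!: sum.cong)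
  also have "\<dots> = (\<Sum>j<d. \<Sum>q=j * n..<j * n + n. X $$ (i, q div n) * (if q mod n = r then 1 else 0) * u $ q)"
    by (rule sum.nat_group[symmetric])
  also have "\<dots> = (\<Sum>j<d. X $$ (i, j) * u $ (j * n + r))"
  proof (intro sum.cong refl)
    fix j
    have "(\<Sum>q=j * n..<j * n + n. X $$ (i, q div n) * (if q mod n = r then 1 else 0) * u $ q)
        = (\<Sum>q=j * n..<j * n + n. if q = j * n + r then X $$ (i, j) * u $ q else 0)"
    proof (intro sum.cong refl)
      fix q assume "q \<in> {j * n..<j * n + n}"
      then obtain s where s: "q = j * n + s" "s < n"
        by (metis add_less_cancel_left atLeastLessThan_iff le_Suc_ex)
      then show "X $$ (i, q div n) * (if q mod n = r then 1 else 0) * u $ q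
          = (if q = j * n + r then X $$ (i, j) * u $ q else 0)" by simp
    qed
    also have "\<dots> = X $$ (i, j) * u $ (j * n + r)" using r by simp
    finally show "(\<Sum>q=j * n..<j * n + n. X $$ (i, q div n) * (if q mod n = r then 1 else 0) * u $ q)
        = X $$ (i, j) * u $ (j * n + r)" .
  qed
  finally show ?thesis .
qed

section \<open>The linearization pencil\<close>

lemma pencil_top_carrier:
  assumes "\<forall>i\<in>{1..d}. C i \<in> carrier_mat n n"
  shows "hcat n (map C [1..<d+1]) \<in> carrier_mat n (d * n)"
proof -
  have "length (concat (map cols (map C [1..<d+1]))) = d * n"
  proof -
    have "map (length \<circ> cols \<circ> C) [1..<d+1] = map (\<lambda>_. n) [1..<d+1]"
    proof (intro map_cong refl)
      fix i assume "i \<in> set [1..<d+1]"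
      then have "C i \<in> carrier_mat n n" using assms by auto
      then show "(length \<circ> cols \<circ> C) i = n" by simp
    qed
    then have "length (concat (map cols (map C [1..<d+1]))) = sum_list (map (\<lambda>_. n) [1..<d+1])"
      by (simp only: length_concat map_map o_assoc)
    then show ?thesis by (simp add: sum_list_triv)
  qed
  then show ?thesis unfolding hcat_def by (metis mat_of_cols_carrier(1))
qed

lemma pencil_carrier:
  assumes "\<forall>i\<in>{1..d}. C i \<in> carrier_mat n n" and "L \<in> carrier_mat k d"
  shows "pencil_mat n d C L \<in> carrier_mat (n + k * n) (d * n)"
  unfolding pencil_mat_def using assms(2)
  by (intro carrier_append_rows pencil_top_carrier[OF assms(1)]) (auto simp: kronecker_def)

lemma pencil_mult_vec:
  assumes C: "\<forall>i\<in>{1..d}. C i \<in> carrier_mat n n"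
    and L: "L \<in> carrier_mat k d" and u: "u \<in> carrier_vec (d * n)"
  shows "vec_block n 1 (pencil_mat n d C L *\<^sub>v u) = hcat n (map C [1..<d+1]) *\<^sub>v u"
    and "i < k \<Longrightarrow> r < n \<Longrightarrow> (pencil_mat n d C L *\<^sub>v u) $ (Suc i * n + r)
      = (\<Sum>j<d. L $$ (i, j) * u $ (j * n + r))"
proof -
  have K: "L \<otimes>\<^sub>K 1\<^sub>m n \<in> carrier_mat (k * n) (d * n)" using L by (auto simp: kronecker_def)
  have eq: "pencil_mat n d C L *\<^sub>v u = (hcat n (map C [1..<d+1]) *\<^sub>v u) @\<^sub>v ((L \<otimes>\<^sub>K 1\<^sub>m n) *\<^sub>v u)"
    unfolding pencil_mat_def by (rule mat_mult_append[OF pencil_top_carrier[OF C] K u])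
  note [simp del] = upt_Suc
  have top: "dim_row (hcat n (map C [1..<d+1])) = n"
    using pencil_top_carrier[OF C] by auto
  show "vec_block n 1 (pencil_mat n d C L *\<^sub>v u) = hcat n (map C [1..<d+1]) *\<^sub>v u"
    unfolding eq using top by (intro eq_vecI) (auto simp: vec_block_def simp del: index_mult_mat_vec)
  assume i: "i < k" and r: "r < n"
  have "(pencil_mat n d C L *\<^sub>v u) $ (Suc i * n + r) = ((L \<otimes>\<^sub>K 1\<^sub>m n) *\<^sub>v u) $ (i * n + r)"
    unfolding eq using top K block_index_less[OF i r]
    by (auto simp del: index_mult_mat_vec simp: add.assoc)
  then show "(pencil_mat n d C L *\<^sub>v u) $ (Suc i * n + r) = (\<Sum>j<d. L $$ (i, j) * u $ (j * n + r))"
    using kronecker_identity_mult_vec_index[OF L u i r] by simp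
qed


lemma shifted_pencil_mult_vec_index:
  assumes A: "\<forall>i\<in>{1..d}. A i \<in> carrier_mat n n" and B: "\<forall>i\<in>{1..d}. B i \<in> carrier_mat n n"
    and M: "M \<in> carrier_mat k d" and N: "N \<in> carrier_mat k d" and u: "u \<in> carrier_vec (d * n)"
    and i: "i < k" and r: "r < n"
  shows "((pencil_mat n d A M - \<sigma> \<cdot>\<^sub>m pencil_mat n d B N) *\<^sub>v u) $ (Suc i * n + r)
      = (\<Sum>j<d. (M - \<sigma> \<cdot>\<^sub>m N) $$ (i, j) * u $ (j * n + r))"
proof -
  note cA = pencil_carrier[OF A M] and cB = pencil_carrier[OF B N]
  have ir: "Suc i * n + r < n + k * n" using block_index_less[OF i r] by simp
  have "((pencil_mat n d A M - \<sigma> \<cdot>\<^sub>m pencil_mat n d B N) *\<^sub>v u) $ (Suc i * n + r)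
      = (pencil_mat n d A M *\<^sub>v u) $ (Suc i * n + r) - \<sigma> * (pencil_mat n d B N *\<^sub>v u) $ (Suc i * n + r)"
    using cA cB u ir
    by (simp add: scalar_prod_def sum_distrib_left sum_subtractf[symmetric] algebra_simps)
  also have "\<dots> = (\<Sum>j<d. (M - \<sigma> \<cdot>\<^sub>m N) $$ (i, j) * u $ (j * n + r))"
    unfolding pencil_mult_vec(2)[OF A M u i r] pencil_mult_vec(2)[OF B N u i r]
    using M N i
    by (simp add: sum_distrib_left sum_subtractf[symmetric] algebra_simps)
  finally show ?thesis .
qed

lemma mat_inverse_invertible:
  fixes Q :: "complex mat"
  assumes Q: "Q \<in> carrier_mat K K" and "invertible_mat Q"
  shows "Q * the (mat_inverse Q) = 1\<^sub>m K" and "the (mat_inverse Q) \<in> carrier_mat K K"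
proof -
  obtain R where R: "Q * R = 1\<^sub>m K" "R * Q = 1\<^sub>m (dim_row R)"
    using assms unfolding invertible_mat_def inverts_mat_def by auto
  have "dim_col R = K" using arg_cong[OF R(1), of dim_col] by simp
  moreover have "dim_row R = K" using arg_cong[OF R(2), of dim_col] Q by simp
  ultimately have "R \<in> carrier_mat K K" by auto
  then have "Q \<in> Units (ring_mat TYPE(complex) K ())"
    using Q R unfolding Units_def ring_mat_def by auto
  then obtain R' where "mat_inverse Q = Some R'"
    using mat_inverse(1)[OF Q, of "()"] by (cases "mat_inverse Q") auto
  with mat_inverse(2)[OF Q this] show "Q * the (mat_inverse Q) = 1\<^sub>m K"
    and "the (mat_inverse Q) \<in> carrier_mat K K" by auto
qed

text \<open>
  A relation \<open>y\<close> between the rows of \<open>M - \<sigma> N\<close> is inherited by the lower block rows of every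
  product \<open>Q u\<close>, where \<open>Q\<close> is the shifted pencil. If \<open>Q\<close> is invertible, every vector is such a
  product, and a unit vector supported in a single lower block shows that the corresponding entry of \<open>y\<close>
  vanishes.
\<close>

lemma shifted_pencil_rows_independent:
  assumes A: "\<forall>i\<in>{1..Suc k}. A i \<in> carrier_mat n n" and B: "\<forall>i\<in>{1..Suc k}. B i \<in> carrier_mat n n"
    and M: "M \<in> carrier_mat k (Suc k)" and N: "N \<in> carrier_mat k (Suc k)" and n: "1 \<le> n"
    and inv: "invertible_mat (pencil_mat n (Suc k) A M - \<sigma> \<cdot>\<^sub>m pencil_mat n (Suc k) B N)"
    and y: "y \<in> carrier_vec k" and y0: "transpose_mat (M - \<sigma> \<cdot>\<^sub>m N) *\<^sub>v y = 0\<^sub>v (Suc k)"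
  shows "y = 0\<^sub>v k"
proof (intro eq_vecI)
  let ?G = "M - \<sigma> \<cdot>\<^sub>m N" and ?d = "Suc k"
  let ?Q = "pencil_mat n ?d A M - \<sigma> \<cdot>\<^sub>m pencil_mat n ?d B N"
  have Q: "?Q \<in> carrier_mat (?d * n) (?d * n)"
    using pencil_carrier[OF A M] pencil_carrier[OF B N] by auto
  fix i assume "i < dim_vec (0\<^sub>v k)"
  then have i: "i < k" by simp
  define w :: "complex vec" where "w = unit_vec (?d * n) (Suc i * n)"
  define u where "u = the (mat_inverse ?Q) *\<^sub>v w"
  have w: "w \<in> carrier_vec (?d * n)" by (simp add: w_def)
  have u: "u \<in> carrier_vec (?d * n)"
    unfolding u_def using mat_inverse_invertible(2)[OF Q inv] w by (rule mult_mat_vec_carrier)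
  have Qu: "?Q *\<^sub>v u = w"
    unfolding u_def
    using assoc_mult_mat_vec[OF Q mat_inverse_invertible(2)[OF Q inv] w] w
    by (simp only: mat_inverse_invertible(1)[OF Q inv] one_mult_mat_vec)
  have Gu: "(\<Sum>j<?d. ?G $$ (l, j) * u $ (j * n)) = (if l = i then 1 else 0)" if l: "l < k" for l
  proof -
    have "Suc l * n < ?d * n" and "Suc i * n < ?d * n"
      using n l i by (intro mult_strict_right_mono; simp)+
    moreover have "Suc l * n = Suc i * n \<longleftrightarrow> l = i" using n by (simp del: mult_Suc)
    ultimately show ?thesis
      using shifted_pencil_mult_vec_index[OF A B M N u l, of 0 \<sigma>] n
      unfolding Qu by (auto simp: w_def simp del: mult_Suc sum.lessThan_Suc)
  qed
  have Gy: "(\<Sum>l<k. ?G $$ (l, j) * y $ l) = 0" if j: "j < ?d" for j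
    using arg_cong[OF y0, of "\<lambda>w. w $ j"] M N y j
    by (simp add: scalar_prod_def lessThan_atLeast0)
  have "y $ i = (\<Sum>l<k. y $ l * (if l = i then 1 else 0))"
    using i by (simp add: if_distrib[of "\<lambda>a. _ * a"] sum.delta cong: if_cong)
  also have "\<dots> = (\<Sum>l<k. \<Sum>j<?d. y $ l * (?G $$ (l, j) * u $ (j * n)))"
    by (intro sum.cong refl) (simp add: Gu[symmetric] sum_distrib_left del: sum.lessThan_Suc)
  also have "\<dots> = (\<Sum>j<?d. (\<Sum>l<k. ?G $$ (l, j) * y $ l) * u $ (j * n))"
    by (subst sum.swap) (simp add: sum_distrib_left mult_ac del: sum.lessThan_Suc)
  also have "\<dots> = 0" by (simp add: Gy del: sum.lessThan_Suc)
  finally show "y $ i = 0\<^sub>v k $ i" using i by simp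
qed (use y in simp)

section \<open>Growth of the block space\<close>

context
  fixes n :: nat
begin

interpretation vec_space "TYPE(complex)" n .

lemma blocks_linear_combination_in_span:
  fixes u :: "nat \<Rightarrow> complex vec"
  assumes T: "T \<subseteq> carrier_vec n"
    and w: "\<And>r. r < d * n \<Longrightarrow> w $ r = (\<Sum>l<k. c l * u l $ r)"
    and u: "\<And>l. l < k \<Longrightarrow> blocks n d (u l) \<subseteq> span T"
  shows "blocks n d w \<subseteq> span T"
  using u linear_combination_in_span[OF T] unfolding blocks_subset_iff
  by (simp add: vec_block_linear_combination[OF _ w])

lemma shifted_solution_blocks_in_span:
  assumes A: "\<forall>i\<in>{1..d}. A i \<in> carrier_mat n n" and B: "\<forall>i\<in>{1..d}. B i \<in> carrier_mat n n"
    and M: "M \<in> carrier_mat (d - 1) d" and N: "N \<in> carrier_mat (d - 1) d"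
    and n: "1 \<le> n" and d: "1 \<le> d"
    and inv: "invertible_mat (pencil_mat n d A M - \<sigma> \<cdot>\<^sub>m pencil_mat n d B N)"
    and u: "u \<in> carrier_vec (d * n)"
    and T: "T \<subseteq> carrier_vec n"
    and w: "blocks n d ((pencil_mat n d A M - \<sigma> \<cdot>\<^sub>m pencil_mat n d B N) *\<^sub>v u) \<subseteq> span T"
  obtains b where "b \<in> carrier_vec n" and "blocks n d u \<subseteq> span (insert b T)"
proof -
  obtain k where dk: "d = Suc k" using d by (cases d) auto
  let ?G = "M - \<sigma> \<cdot>\<^sub>m N"
  have eqs: "vec n (\<lambda>r. \<Sum>j<Suc k. ?G $$ (i, j) * vec_block n (Suc j) u $ r) \<in> span T" if i: "i < k" for i
  proof -
    have "vec_block n (Suc (Suc i)) ((pencil_mat n d A M - \<sigma> \<cdot>\<^sub>m pencil_mat n d B N) *\<^sub>v u)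
        = vec n (\<lambda>r. \<Sum>j<Suc k. ?G $$ (i, j) * vec_block n (Suc j) u $ r)"
    proof (intro eq_vecI)
      fix r assume "r < dim_vec (vec n (\<lambda>r. \<Sum>j<Suc k. ?G $$ (i, j) * vec_block n (Suc j) u $ r))"
      then have r: "r < n" by simp
      show "vec_block n (Suc (Suc i)) ((pencil_mat n d A M - \<sigma> \<cdot>\<^sub>m pencil_mat n d B N) *\<^sub>v u) $ r
          = vec n (\<lambda>r. \<Sum>j<Suc k. ?G $$ (i, j) * vec_block n (Suc j) u $ r) $ r"
        using shifted_pencil_mult_vec_index[OF A B M N u _ r, of i \<sigma>] i r
        by (simp add: dk del: sum.lessThan_Suc mult_Suc)
    qed simp
    then show ?thesis using w i unfolding blocks_subset_iff dk by (metis Suc_less_eq)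
  qed
  have G: "?G \<in> carrier_mat k (Suc k)" using M N by (auto simp: dk)
  obtain p where "p < Suc k" "\<And>j. j < Suc k \<Longrightarrow> vec_block n (Suc j) u \<in> span (insert (vec_block n (Suc p) u) T)"
  proof (rule corank_one_solutions_in_span_of_one_unknown[OF G _ T, of "\<lambda>j. vec_block n (Suc j) u"])
    fix y assume "y \<in> carrier_vec k" "transpose_mat ?G *\<^sub>v y = 0\<^sub>v (Suc k)"
    then show "y = 0\<^sub>v k"
      using shifted_pencil_rows_independent[of k A n B M N \<sigma> y] A B M N n inv by (simp add: dk)
  qed (use eqs in auto)
  then show thesis
    using that[of "vec_block n (Suc p) u"] by (simp add: blocks_subset_iff dk)
qed

lemma pencil_image_blocks_in_span:
  assumes B: "\<forall>i\<in>{1..d}. B i \<in> carrier_mat n n"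
    and N: "N \<in> carrier_mat (d - 1) d" and d: "1 \<le> d"
    and u: "u \<in> carrier_vec (d * n)"
    and T: "T \<subseteq> carrier_vec n"
    and uT: "blocks n d u \<subseteq> span T"
    and top: "hcat n (map B [1..<d+1]) *\<^sub>v u \<in> span T"
  shows "blocks n d (pencil_mat n d B N *\<^sub>v u) \<subseteq> span T"
  unfolding blocks_subset_iff
proof (intro allI impI)
  fix j assume j: "j < d"
  show "vec_block n (Suc j) (pencil_mat n d B N *\<^sub>v u) \<in> span T"
  proof (cases j)
    case 0
    then show ?thesis using pencil_mult_vec(1)[OF B N u] top by simp
  next
    case (Suc i)
    then have i: "i < d - 1" using j by simp
    have "vec_block n (Suc j) (pencil_mat n d B N *\<^sub>v u)
        = vec n (\<lambda>r. \<Sum>l<d. N $$ (i, l) * vec_block n (Suc l) u $ r)"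
      using pencil_mult_vec(2)[OF B N u i] Suc by (intro eq_vecI) (simp_all del: mult_Suc)
    then show ?thesis
      using linear_combination_in_span[OF T, of d "\<lambda>l. vec_block n (Suc l) u"] uT
      by (simp add: blocks_subset_iff)
  qed
qed

text \<open>
  The number \<open>e\<close> is the price of the first block of \<open>x\<^sub>k\<close>, that is, the number of vectors to be
  added to a space containing the blocks of \<open>u\<close> so that it also contains \<open>[B\<^sub>1 \<dots> B\<^sub>d] u\<close>. It is the
  only place where the two cases of the theorem differ.
\<close>

lemma krylov_blocks_in_small_span:
  assumes A: "\<forall>i\<in>{1..d}. A i \<in> carrier_mat n n" and B: "\<forall>i\<in>{1..d}. B i \<in> carrier_mat n n"
    and M: "M \<in> carrier_mat (d - 1) d" and N: "N \<in> carrier_mat (d - 1) d"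
    and n: "1 \<le> n" and d: "1 \<le> d"
    and krylov: "rational_krylov (d * n) (pencil_mat n d A M) (pencil_mat n d B N) m \<sigma> t v z x h"
    and T0: "finite T0" "T0 \<subseteq> carrier_vec n" "blocks n d (v 1) \<subseteq> span T0"
    and top: "\<And>u T. u \<in> carrier_vec (d * n) \<Longrightarrow> T \<subseteq> carrier_vec n \<Longrightarrow> blocks n d u \<subseteq> span T \<Longrightarrow>
      \<exists>E. finite E \<and> E \<subseteq> carrier_vec n \<and> card E \<le> e \<and> hcat n (map B [1..<d+1]) *\<^sub>v u \<in> span (T \<union> E)"
    and k: "1 \<le> k" "k \<le> m"
  shows "\<exists>T. finite T \<and> T \<subseteq> carrier_vec n \<and> card T \<le> card T0 + (1 + e) * (k - 1)
    \<and> (\<forall>l\<in>{1..k}. blocks n d (v l) \<subseteq> span T) \<and> (\<forall>l\<in>{1..<k}. blocks n d (z l) \<subseteq> span T)"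
  using k
proof (induction k rule: dec_induct)
  case base
  then show ?case using T0 by (intro exI[of _ T0]) auto
next
  case (step k)
  then obtain T where T: "finite T" "T \<subseteq> carrier_vec n" "card T \<le> card T0 + (1 + e) * (k - 1)"
    "\<And>l. l \<in> {1..k} \<Longrightarrow> blocks n d (v l) \<subseteq> span T" "\<And>l. l \<in> {1..<k} \<Longrightarrow> blocks n d (z l) \<subseteq> span T"
    by auto
  let ?K = "d * n"
  let ?Q = "pencil_mat n d A M - \<sigma> k \<cdot>\<^sub>m pencil_mat n d B N"
  let ?w = "basis_mat ?K v k *\<^sub>v t k"
  have "k \<in> {1..<m}" using step by auto
  then have kr: "invertible_mat ?Q" "t k \<in> carrier_vec k" "z k = the (mat_inverse ?Q) *\<^sub>v ?w"
      "x k = pencil_mat n d B N *\<^sub>v z k" "h k \<in> carrier_vec (k + 1)" "h k $ k \<noteq> 0"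
      "x k = basis_mat ?K v (k + 1) *\<^sub>v h k"
    using krylov unfolding rational_krylov_def by blast+
  have K: "n + (d - 1) * n = ?K" using d by (cases d) auto
  have Q: "?Q \<in> carrier_mat ?K ?K"
    using pencil_carrier[OF A M] pencil_carrier[OF B N] unfolding K by auto
  have w: "?w \<in> carrier_vec ?K"
    by (rule mult_mat_vec_carrier[OF _ kr(2)]) (rule basis_mat_carrier)
  have wT: "blocks n d ?w \<subseteq> span T"
  proof (rule blocks_linear_combination_in_span[OF T(2),
        where k = k and c = "\<lambda>l. t k $ l" and u = "\<lambda>l. v (Suc l)"])
    show "?w $ r = (\<Sum>l<k. t k $ l * v (Suc l) $ r)" if "r < ?K" for r
      using that kr(2) by (rule basis_mat_mult_vec_index)
    show "blocks n d (v (Suc l)) \<subseteq> span T" if "l < k" for l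
      using that by (intro T(4)) simp
  qed
  have z: "z k \<in> carrier_vec ?K"
    unfolding kr(3) using mat_inverse_invertible(2)[OF Q kr(1)] w by (rule mult_mat_vec_carrier)
  have Qz: "?Q *\<^sub>v z k = ?w"
    unfolding kr(3)
    using assoc_mult_mat_vec[OF Q mat_inverse_invertible(2)[OF Q kr(1)] w] w
    by (simp only: mat_inverse_invertible(1)[OF Q kr(1)] one_mult_mat_vec)
  obtain b where b: "b \<in> carrier_vec n" "blocks n d (z k) \<subseteq> span (insert b T)"
    by (rule shifted_solution_blocks_in_span[OF A B M N n d kr(1) z T(2) wT[folded Qz]])
  have bT: "insert b T \<subseteq> carrier_vec n" using b T by auto
  obtain E where E: "finite E" "E \<subseteq> carrier_vec n" "card E \<le> e"
      "hcat n (map B [1..<d+1]) *\<^sub>v z k \<in> span (insert b T \<union> E)"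
    using top[OF z bT b(2)] by auto
  let ?T = "insert b T \<union> E"
  have T': "?T \<subseteq> carrier_vec n" using bT E by auto
  have mono: "span T \<subseteq> span ?T" "span (insert b T) \<subseteq> span ?T"
    by (intro span_is_monotone; auto)+
  have zT: "blocks n d (z k) \<subseteq> span ?T"
    using b(2) mono(2) by (rule subset_trans)
  have xT: "blocks n d (x k) \<subseteq> span ?T"
    unfolding kr(4) by (rule pencil_image_blocks_in_span[OF B N d z T' zT E(4)])
  have vT_old: "blocks n d (v l) \<subseteq> span ?T" if "l \<in> {1..k}" for l
    using T(4)[OF that] mono(1) by (rule subset_trans)
  have zT_old: "blocks n d (z l) \<subseteq> span ?T" if "l \<in> {1..<k}" for l
    using T(5)[OF that] mono(1) by (rule subset_trans)
  have vT: "blocks n d (v (Suc k)) \<subseteq> span ?T"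
  proof (rule blocks_linear_combination_in_span[OF T', where k = "Suc k"
        and c = "\<lambda>l. (if l < k then - h k $ l else 1) / h k $ k" and u = "\<lambda>l. if l < k then v (Suc l) else x k"])
    \<comment> \<open>Solve \<open>x\<^sub>k = V\<^bsub>k+1\<^esub> h\<^sub>k\<close> for the last column of \<open>V\<^bsub>k+1\<^esub>\<close>.\<close>
    fix r assume r: "r < ?K"
    have "x k $ r = (\<Sum>l<k. h k $ l * v (Suc l) $ r) + h k $ k * v (Suc k) $ r"
      using basis_mat_mult_vec_index[OF r kr(5), of v] by (simp add: kr(7))
    then have "v (Suc k) $ r = x k $ r / h k $ k - (\<Sum>l<k. h k $ l * v (Suc l) $ r) / h k $ k"
      using kr(6) by (simp add: field_simps)
    then show "v (Suc k) $ r = (\<Sum>l<Suc k. (if l < k then - h k $ l else 1) / h k $ k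
        * (if l < k then v (Suc l) else x k) $ r)"
      by (simp add: sum_divide_distrib sum_negf)
  next
    fix l assume "l < Suc k"
    then show "blocks n d (if l < k then v (Suc l) else x k) \<subseteq> span ?T"
      using vT_old[of "Suc l"] xT by simp
  qed
  have "card ?T \<le> card T + 1 + e"
    using card_Un_le[of "insert b T" E] card_insert_le_m1[of "Suc (card T)" T b] E(3) by simp
  also have "\<dots> \<le> card T0 + (1 + e) * (Suc k - 1)"
    using T(3) step(1) by (cases k) auto
  finally have card: "card ?T \<le> card T0 + (1 + e) * (Suc k - 1)" .
  have "blocks n d (v l) \<subseteq> span ?T" if "l \<in> {1..Suc k}" for l
    using that vT_old[of l] vT by (cases "l = Suc k") simp_all
  moreover have "blocks n d (z l) \<subseteq> span ?T" if "l \<in> {1..<Suc k}" for l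
    using that zT_old[of l] zT by (cases "l = k") simp_all
  ultimately show ?case using T(1) E(1) T' card by (intro exI[of _ ?T] conjI ballI) simp_all
qed

lemma block_matrix_rank_le_card:
  assumes T: "T \<subseteq> carrier_vec n" "finite T"
    and v: "\<And>l. l \<in> {1..a} \<Longrightarrow> blocks n d (v l) \<subseteq> span T"
    and z: "\<And>l. l \<in> {1..b} \<Longrightarrow> blocks n d (z l) \<subseteq> span T"
  shows "rank (hcat n (map (\<lambda>i. mat_block n i (basis_mat (d * n) v a)) [1..<d+1]
    @ map (\<lambda>i. mat_block n i (basis_mat (d * n) z b)) [1..<d+1])) \<le> card T"
    (is "rank (hcat n ?Xs) \<le> _")
proof -
  have cols: "set (cols (mat_block n i (basis_mat (d * n) w k))) \<subseteq> span T"
    if "i \<in> {1..d}" and w: "\<And>l. l \<in> {1..k} \<Longrightarrow> blocks n d (w l) \<subseteq> span T" for i k w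
  proof -
    from that(1) obtain j where j: "i = Suc j" "j < d" by (cases i) auto
    have "dim_col (mat_block n i (basis_mat (d * n) w k)) = k"
      by (simp add: mat_block_def basis_mat_def del: upt_Suc)
    then show ?thesis
      using w j by (auto simp: cols_def col_mat_block_basis_mat blocks_subset_iff)
  qed
  have sub: "set (concat (map cols ?Xs)) \<subseteq> span T"
  proof -
    have "set (cols X) \<subseteq> span T" if X: "X \<in> set ?Xs" for X
    proof -
      have "\<exists>i\<in>{1..d}. X = mat_block n i (basis_mat (d * n) v a) \<or> X = mat_block n i (basis_mat (d * n) z b)"
        using X by (auto simp del: upt_Suc simp: less_Suc_eq_le)
      then obtain i where i: "i \<in> {1..d}" and
        "X = mat_block n i (basis_mat (d * n) v a) \<or> X = mat_block n i (basis_mat (d * n) z b)" by blast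
      then show ?thesis by (elim disjE) (simp_all only: cols[OF i v] cols[OF i z])
    qed
    then show ?thesis unfolding set_concat set_map by blast
  qed
  then have "set (concat (map cols ?Xs)) \<subseteq> carrier_vec n"
    using span_is_subset2[of T] T by (auto simp: module_vec_simps)
  then have "cols (hcat n ?Xs) = concat (map cols ?Xs)"
    unfolding hcat_def by (rule cols_mat_of_cols)
  then show ?thesis
    using rank_le_card_generators[OF _ T] sub mat_of_cols_carrier(1) unfolding hcat_def by metis
qed

end

theorem theorem3p7:
  fixes n d m :: nat and \<Omega> :: "complex set"
    and A B :: "nat \<Rightarrow> complex mat" and M N :: "complex mat"
    and f :: "complex \<Rightarrow> complex vec" and P :: "complex \<Rightarrow> complex mat"
    and \<sigma> :: "nat \<Rightarrow> complex" and t v z x h :: "nat \<Rightarrow> complex vec"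
  defines "V \<equiv> basis_mat (d * n) v m" and "Z \<equiv> basis_mat (d * n) z (m - 1)"
  defines "r \<equiv> vec_space.rank n
    (hcat n (map (\<lambda>i. mat_block n i V) [1..<d+1] @ map (\<lambda>i. mat_block n i Z) [1..<d+1]))"
  defines "d' \<equiv> vec_space.span_dim n ((\<lambda>i. vec_block n i (v 1)) ` {1..d})"
  assumes "linearization_data n d \<Omega> A B f P M N"
    and "1 \<le> m"
    and "rational_krylov (d * n) (pencil_mat n d A M) (pencil_mat n d B N) m \<sigma> t v z x h"
  shows "r \<le> d' + 2 * (m - 1) \<and>
    ((\<exists>c\<^sub>B \<in> carrier_vec d. hcat n (map B [1..<d+1]) = mat_of_row c\<^sub>B \<otimes>\<^sub>K 1\<^sub>m n) \<longrightarrow>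
      r \<le> d' + 1 * (m - 1))"
proof -
  interpret vec_space "TYPE(complex)" n .
  have dims: "1 \<le> n" "1 \<le> d" "\<forall>i\<in>{1..d}. A i \<in> carrier_mat n n"
      "\<forall>i\<in>{1..d}. B i \<in> carrier_mat n n" "M \<in> carrier_mat (d - 1) d" "N \<in> carrier_mat (d - 1) d"
    using assms(5) unfolding linearization_data_def by auto
  have "blocks n d (v 1) \<subseteq> carrier_vec n" and "finite (blocks n d (v 1))"
    by (auto simp: blocks_def)
  then obtain T0 where T0: "T0 \<subseteq> blocks n d (v 1)" "card T0 = d'" "blocks n d (v 1) \<subseteq> span T0"
    by (rule spanning_subset_of_size_span_dim) (simp add: d'_def blocks_def)
  have T0': "finite T0" "T0 \<subseteq> carrier_vec n"
    using T0(1) by (auto simp: blocks_def intro: finite_subset)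
  have bound: "r \<le> d' + (1 + e) * (m - 1)"
    if top: "\<And>u T. u \<in> carrier_vec (d * n) \<Longrightarrow> T \<subseteq> carrier_vec n \<Longrightarrow> blocks n d u \<subseteq> span T \<Longrightarrow>
      \<exists>E. finite E \<and> E \<subseteq> carrier_vec n \<and> card E \<le> e \<and> hcat n (map B [1..<d+1]) *\<^sub>v u \<in> span (T \<union> E)" for e
  proof -
    obtain T where T: "finite T" "T \<subseteq> carrier_vec n" "card T \<le> card T0 + (1 + e) * (m - 1)"
        "\<forall>l\<in>{1..m}. blocks n d (v l) \<subseteq> span T" "\<forall>l\<in>{1..<m}. blocks n d (z l) \<subseteq> span T"
      using krylov_blocks_in_small_span[OF dims(3-6,1,2) assms(7) T0' T0(3) top assms(6) order_refl]
      by blast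
    have "r \<le> card T"
      unfolding r_def V_def Z_def using T assms(6)
      by (intro block_matrix_rank_le_card) auto
    then show ?thesis using T(3) T0(2) by simp
  qed
  have top_carrier: "hcat n (map B [1..<d+1]) *\<^sub>v u \<in> carrier_vec n" if "u \<in> carrier_vec (d * n)" for u
    using pencil_top_carrier[OF dims(4)] that by (rule mult_mat_vec_carrier)
  have "r \<le> d' + (1 + 1) * (m - 1)"
  proof (rule bound)
    fix u :: "complex vec" and T :: "complex vec set" assume u: "u \<in> carrier_vec (d * n)" and T: "T \<subseteq> carrier_vec n"
    let ?E = "{hcat n (map B [1..<d+1]) *\<^sub>v u}"
    have "hcat n (map B [1..<d+1]) *\<^sub>v u \<in> span (T \<union> ?E)"
      using in_own_span[of "T \<union> ?E"] T top_carrier[OF u] by (auto simp: module_vec_simps)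
    then show "\<exists>E. finite E \<and> E \<subseteq> carrier_vec n \<and> card E \<le> 1 \<and> hcat n (map B [1..<d+1]) *\<^sub>v u \<in> span (T \<union> E)"
      using top_carrier[OF u] by (intro exI[of _ ?E]) auto
  qed
  moreover have "r \<le> d' + (1 + 0) * (m - 1)"
    if c: "c\<^sub>B \<in> carrier_vec d" and hc: "hcat n (map B [1..<d+1]) = mat_of_row c\<^sub>B \<otimes>\<^sub>K 1\<^sub>m n" for c\<^sub>B
  proof (rule bound)
    fix u :: "complex vec" and T :: "complex vec set" assume u: "u \<in> carrier_vec (d * n)" and T: "T \<subseteq> carrier_vec n" and uT: "blocks n d u \<subseteq> span T"
    have R: "mat_of_row c\<^sub>B \<in> carrier_mat 1 d" using c by simp
    have "hcat n (map B [1..<d+1]) *\<^sub>v u = vec n (\<lambda>r. \<Sum>j<d. c\<^sub>B $ j * vec_block n (Suc j) u $ r)"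
    proof (intro eq_vecI)
      fix r assume "r < dim_vec (vec n (\<lambda>r. \<Sum>j<d. c\<^sub>B $ j * vec_block n (Suc j) u $ r))"
      then have r: "r < n" by simp
      then show "(hcat n (map B [1..<d+1]) *\<^sub>v u) $ r
          = vec n (\<lambda>r. \<Sum>j<d. c\<^sub>B $ j * vec_block n (Suc j) u $ r) $ r"
        using kronecker_identity_mult_vec_index[OF R u, of 0 r] c
        unfolding hc by (simp del: index_mult_mat_vec)
    qed (use pencil_top_carrier[OF dims(4)] in \<open>simp del: upt_Suc\<close>)
    then have "hcat n (map B [1..<d+1]) *\<^sub>v u \<in> span T"
      using linear_combination_in_span[OF T, of d "\<lambda>j. vec_block n (Suc j) u"] uT
      by (simp add: blocks_subset_iff)
    then show "\<exists>E. finite E \<and> E \<subseteq> carrier_vec n \<and> card E \<le> 0 \<and> hcat n (map B [1..<d+1]) *\<^sub>v u \<in> span (T \<union> E)"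
      by (intro exI[of _ "{}"]) simp
  qed
  ultimately show ?thesis by auto
qed

end
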